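(* (Quasi-associativity.) Let $V$ be an $N_W=N$ SUSY vertex algebra. For every homogeneous $a,b,c\in V$, with $:ab:\,=a_{(-1|N)}b$, $$::ab:c:-:a:bc::\;=\;\sum_{j\ge0}a_{(-2-j|N)}\bigl(b_{(j|N)}c\bigr)+(-1)^{ab}\sum_{j\ge0}b_{(-2-j|N)}\bigl(a_{(j|N)}c\bigr).$$ Equivalently, $$::ab:c:-:a:bc::\;=\;\Bigl(\int_0^\nabla d\Lambda\,a\Bigr)[b_\Lambda c]+(-1)^{ab}\Bigl(\int_0^\nabla d\Lambda\,b\Bigr)[a_\Lambda c].$$
   Context: Ground field $\mathbb C$; $N\ge0$ a fixed integer. $Z=(z,\theta^1,\dots,\theta^N)$, $W=(w,\zeta^1,\dots,\zeta^N)$, $z,w$ even, $\theta^i,\zeta^i$ odd; odd variables anticommute with each other and supercommute with elements of superspaces; $[\ ,\ ]$ is the supercommutator. In exponents of $-1$, $a$ means the parity of $a$ and $J$ means $\#J$. For $J=\{j_1<\dots<j_k\}\subset\{1,\dots,N\}$, $\theta^J=\theta^{j_1}\cdots\theta^{j_k}$, $Z^{j|J}=z^j\theta^J$; "$N$" as a set means $\{1,\dots,N\}$; $\sigma(J)=\pm1$ is defined by $\theta^J\theta^{N\setminus J}=\sigma(J)\theta^1\cdots\theta^N$. An $N_W=N$ SUSY vertex algebra is a vector superspace $V$ with an even vector $|0\rangle$, an even operator $T$, odd operators $S^1,\dots,S^N$, and a parity preserving linear map $Y$ sending $a\in V$ to an $\mathrm{End}(V)$-valued field $Y(a,Z)=\sum_{j\in\mathbb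 Z,J}Z^{-1-j|N\setminus J}a_{(j|J)}$, $a_{(j|J)}\in\mathrm{End}(V)$ (field: $Y(a,Z)b\in V((z))[\theta^1,\dots,\theta^N]$ for all $b$), such that: $Y(a,Z)|0\rangle\in V[[z]][\theta^1,\dots,\theta^N]$ has value $a$ at $Z=0$, $T|0\rangle=S^i|0\rangle=0$; $[T,Y(a,Z)]=\partial_zY(a,Z)$, $[S^i,Y(a,Z)]=\partial_{\theta^i}Y(a,Z)$; for all $a,b$, $(z-w)^n[Y(a,Z),Y(b,W)]=0$ for some $n\ge0$. One writes $a_{(j|J)}b=a_{(j|J)}(b)$. The $\Lambda$-bracket on $V$ is $[a_\Lambda b]=\sum_{j\ge0,J}(-1)^{JN}\sigma(J)\Lambda^{(j|J)}a_{(j|J)}b$, with $\Lambda=(\lambda,\chi^1,\dots,\chi^N)$, $\lambda$ even, $\chi^i$ odd supercommuting parameters, $\Lambda^{(j|J)}=\frac{(-1)^{J(J+1)/2}}{j!}\lambda^j\chi^{j_1}\cdots\chi^{j_k}$. The expression $\bigl(\int_0^\nabla d\Lambda\,a\bigr)[b_\Lambda c]$, $\nabla=(T,S^1,\dots,S^N)$, is computed as follows: expand $[b_\Lambda c]=\sum P_r(\Lambda)e_r$ with $P_r$ polynomials in $\Lambda$ and $e_r\in V$, put the powers of $\Lambda$ on the left under the integral sign, and take $\sum_r:\bigl(\int_0^\nabla P_r\,d\Lambda\;a\bigr)e_r:$, where $\int_0^\nabla P\,d\Lambda$ is obtained by applying $\partial_{\chi^1}\cdots\partial_{\chi^N}$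 to $P$ and then taking the definite integral in $\lambda$ from $0$ to $T$ (the resulting polynomial in $T$ acting on $a$). *)

theory Defs
  imports Complex_Main "HOL-Library.Groups_Big_Fun" "HOL-Computational_Algebra.Polynomial"
begin

section \<open>Superspaces\<close>

text \<open>
  The complex vector space \<open>V\<close> is the whole type \<open>'v\<close> with an explicit scalar multiplication.
  Parities are natural numbers read modulo 2; the zero vector is homogeneous of both parities.
\<close>

definition homog :: "'v set \<Rightarrow> 'v set \<Rightarrow> nat \<Rightarrow> 'v set" where
  "homog V0 V1 p = (if even p then V0 else V1)"

locale superspace = vector_space scale
  for scale :: "complex \<Rightarrow> 'v::ab_group_add \<Rightarrow> 'v" +
  fixes V0 V1 :: "'v set"
  assumes subspace_even: "subspace V0"
    and subspace_odd: "subspace V1"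
    and direct: "V0 \<inter> V1 = {0}"
    and spanning: "\<forall>v. \<exists>x\<in>V0. \<exists>y\<in>V1. v = x + y"


section \<open>Odd variables\<close>

text \<open>
  For disjoint finite \<open>J\<close>, \<open>K\<close>, sorting the factors gives
  \<open>\<theta>\<^sup>J \<theta>\<^sup>K = grass_sign J K \<cdot> \<theta>\<^bsup>J \<union> K\<^esup>\<close>: each pair \<open>k < j\<close> with \<open>j \<in> J\<close>, \<open>k \<in> K\<close>
  contributes one transposition of odd variables.
\<close>

definition grass_sign :: "nat set \<Rightarrow> nat set \<Rightarrow> complex" where
  "grass_sign J K = (- 1) ^ card {(j, k). j \<in> J \<and> k \<in> K \<and> k < j}"

text \<open>\<open>\<theta>\<^sup>J \<theta>\<^bsup>N - J\<^esup> = sigma N J \<cdot> \<theta>\<^sup>1 \<dots> \<theta>\<^sup>N\<close>\<close>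

definition sigma :: "nat \<Rightarrow> nat set \<Rightarrow> complex" where
  "sigma N J = grass_sign J ({1..N} - J)"


section \<open>Distributions with values in \<open>End(V)\<close>\<close>

text \<open>
  A series \<open>\<Sum> z\<^sup>m \<theta>\<^sup>K A\<^bsub>m,K\<^esub>\<close> (\<open>m\<close> an integer, \<open>K \<subseteq> {1..N}\<close>, coefficients to the right of the
  variables) is its coefficient family; a series in \<open>Z\<close> and \<open>W\<close> is the family of coefficients
  of \<open>z\<^sup>m \<theta>\<^sup>K w\<^sup>n \<zeta>\<^sup>L\<close>, in this order.
\<close>

type_synonym 'v sdist = "int \<Rightarrow> nat set \<Rightarrow> 'v \<Rightarrow> 'v"
type_synonym 'v sdist2 = "int \<Rightarrow> nat set \<Rightarrow> int \<Rightarrow> nat set \<Rightarrow> 'v \<Rightarrow> 'v"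

definition deriv_z :: "(complex \<Rightarrow> 'v \<Rightarrow> 'v) \<Rightarrow> 'v sdist \<Rightarrow> 'v sdist" where
  "deriv_z scale A = (\<lambda>m K v. scale (of_int (m + 1)) (A (m + 1) K v))"

text \<open>Left derivative: \<open>\<partial>\<^sub>i\<close> kills \<open>\<theta>\<^sup>J\<close> if \<open>i \<notin> J\<close> and removes the leading factor of \<open>\<theta>\<^sup>i \<theta>\<^sup>K\<close>.\<close>

definition deriv_theta :: "(complex \<Rightarrow> 'v::zero \<Rightarrow> 'v) \<Rightarrow> nat \<Rightarrow> 'v sdist \<Rightarrow> 'v sdist" where
  "deriv_theta scale i A =
     (\<lambda>m K v. if i \<in> K then 0 else scale (grass_sign {i} K) (A m (insert i K) v))"

text \<open>
  The supercommutator \<open>[X, A(Z)] = X A(Z) - (-1)\<^bsup>pq\<^esup> A(Z) X\<close> of an operator \<open>X\<close> of parity \<open>p\<close> with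
  a series \<open>A(Z)\<close> of total parity \<open>q\<close>; moving \<open>X\<close> past \<open>\<theta>\<^sup>K\<close> gives the sign \<open>(-1)\<^bsup>p #K\<^esup>\<close>.
\<close>

definition scomm_op ::
  "(complex \<Rightarrow> 'v::ab_group_add \<Rightarrow> 'v) \<Rightarrow> nat \<Rightarrow> nat \<Rightarrow> ('v \<Rightarrow> 'v) \<Rightarrow> 'v sdist \<Rightarrow> 'v sdist" where
  "scomm_op scale p q X A =
     (\<lambda>m K v. scale ((- 1) ^ (p * card K)) (X (A m K v)) - scale ((- 1) ^ (p * q)) (A m K (X v)))"

text \<open>
  The products \<open>A(Z) B(W)\<close> and \<open>B(W) A(Z)\<close> for \<open>A\<close>, \<open>B\<close> of total parities \<open>p\<close>, \<open>q\<close>.  The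
  coefficient \<open>A\<^bsub>m,K\<^esub>\<close> has parity \<open>p + #K\<close> and has to move past \<open>\<zeta>\<^sup>L\<close>; in the second product
  \<open>B\<^bsub>n,L\<^esub>\<close> moves past \<open>\<theta>\<^sup>K\<close>, and \<open>\<zeta>\<^sup>L \<theta>\<^sup>K = (-1)\<^bsup>#K #L\<^esup> \<theta>\<^sup>K \<zeta>\<^sup>L\<close>.
\<close>

definition prod_ZW ::
  "(complex \<Rightarrow> 'v \<Rightarrow> 'v) \<Rightarrow> nat \<Rightarrow> 'v sdist \<Rightarrow> 'v sdist \<Rightarrow> 'v sdist2" where
  "prod_ZW scale p A B =
     (\<lambda>m K n L v. scale ((- 1) ^ ((p + card K) * card L)) (A m K (B n L v)))"

definition prod_WZ ::
  "(complex \<Rightarrow> 'v \<Rightarrow> 'v) \<Rightarrow> nat \<Rightarrow> 'v sdist \<Rightarrow> 'v sdist \<Rightarrow> 'v sdist2" where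
  "prod_WZ scale q B A =
     (\<lambda>m K n L v. scale ((- 1) ^ ((q + card L) * card K + card K * card L)) (B n L (A m K v)))"

definition scomm ::
  "(complex \<Rightarrow> 'v::ab_group_add \<Rightarrow> 'v) \<Rightarrow> nat \<Rightarrow> nat \<Rightarrow> 'v sdist \<Rightarrow> 'v sdist \<Rightarrow> 'v sdist2" where
  "scomm scale p q A B =
     (\<lambda>m K n L v. prod_ZW scale p A B m K n L v
        - scale ((- 1) ^ (p * q)) (prod_WZ scale q B A m K n L v))"

definition mult_z_minus_w :: "'v::ab_group_add sdist2 \<Rightarrow> 'v sdist2" where
  "mult_z_minus_w F = (\<lambda>m K n L v. F (m - 1) K n L v - F m K (n - 1) L v)"


section \<open>SUSY vertex algebras\<close>

locale susy_vertex_algebra = superspace scale V0 V1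
  for scale :: "complex \<Rightarrow> 'v::ab_group_add \<Rightarrow> 'v" and V0 V1 :: "'v set" +
  fixes N :: nat
    and vac :: 'v
    and T :: "'v \<Rightarrow> 'v"
    and S :: "nat \<Rightarrow> 'v \<Rightarrow> 'v"
    and Y :: "'v \<Rightarrow> 'v sdist"
  assumes vac_even: "vac \<in> V0"
    and T_linear: "Vector_Spaces.linear scale scale T"
    and T_even: "v \<in> homog V0 V1 p \<Longrightarrow> T v \<in> homog V0 V1 p"
    and S_linear: "i \<in> {1..N} \<Longrightarrow> Vector_Spaces.linear scale scale (S i)"
    and S_odd: "i \<in> {1..N} \<Longrightarrow> v \<in> homog V0 V1 p \<Longrightarrow> S i v \<in> homog V0 V1 (p + 1)"
    and Y_support: "\<not> K \<subseteq> {1..N} \<Longrightarrow> Y a m K v = 0"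
    and Y_operator: "Vector_Spaces.linear scale scale (Y a m K)"
    and Y_linear: "Vector_Spaces.linear scale scale (\<lambda>a. Y a m K v)"
    and Y_parity: "a \<in> homog V0 V1 p \<Longrightarrow> v \<in> homog V0 V1 q \<Longrightarrow> K \<subseteq> {1..N} \<Longrightarrow>
          Y a m K v \<in> homog V0 V1 (p + card K + q)"
    and Y_field: "\<exists>M. \<forall>m<M. \<forall>K. Y a m K b = 0"
    and Y_vacuum: "m < 0 \<Longrightarrow> Y a m K vac = 0"
    and Y_creation: "Y a 0 {} vac = a"
    and T_vacuum: "T vac = 0"
    and S_vacuum: "i \<in> {1..N} \<Longrightarrow> S i vac = 0"
    and T_translation: "a \<in> homog V0 V1 p \<Longrightarrow> scomm_op scale 0 p T (Y a) = deriv_z scale (Y a)"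
    and S_translation: "a \<in> homog V0 V1 p \<Longrightarrow> i \<in> {1..N} \<Longrightarrow>
          scomm_op scale 1 p (S i) (Y a) = deriv_theta scale i (Y a)"
    and locality: "a \<in> homog V0 V1 p \<Longrightarrow> b \<in> homog V0 V1 q \<Longrightarrow>
          \<exists>n. (mult_z_minus_w ^^ n) (scomm scale p q (Y a) (Y b)) = (\<lambda>m K n L v. 0)"

text \<open>\<open>a\<^bsub>(j|J)\<^esub>\<close> is the coefficient of \<open>Z\<^bsup>-1-j|N - J\<^esup>\<close> in \<open>Y(a,Z)\<close>.\<close>

definition mode :: "nat \<Rightarrow> ('v \<Rightarrow> 'v sdist) \<Rightarrow> 'v \<Rightarrow> int \<Rightarrow> nat set \<Rightarrow> 'v \<Rightarrow> 'v" where
  "mode N Y a j J = Y a (- 1 - j) ({1..N} - J)"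

definition normal_prod :: "nat \<Rightarrow> ('v \<Rightarrow> 'v sdist) \<Rightarrow> 'v \<Rightarrow> 'v \<Rightarrow> 'v" where
  "normal_prod N Y a b = mode N Y a (- 1) {1..N} b"


section \<open>The \<open>\<Lambda>\<close>-bracket and the integral\<close>

text \<open>
  Polynomials in \<open>\<Lambda> = (\<lambda>, \<chi>\<^sup>1, \<dots>, \<chi>\<^sup>N)\<close> over \<open>\<complex>\<close> are written
  \<open>P = \<Sum> \<chi>\<^sup>J P\<^sub>J(\<lambda>)\<close>; a polynomial in \<open>\<Lambda>\<close> with values in \<open>V\<close> is its family of coefficients of
  \<open>\<lambda>\<^sup>j \<chi>\<^sup>J\<close>, written to the right of the parameters.
\<close>

type_synonym lpoly = "nat set \<Rightarrow> complex poly"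
type_synonym 'v lpoly_val = "nat \<Rightarrow> nat set \<Rightarrow> 'v"

definition lam_monom :: "nat \<Rightarrow> nat set \<Rightarrow> lpoly" where
  "lam_monom j J = (\<lambda>K. if K = J then monom 1 j else 0)"

text \<open>
  The coefficient of \<open>\<lambda>\<^sup>j \<chi>\<^sup>J\<close> in \<open>\<Lambda>\<^bsup>(j|J)\<^esup>\<close> is \<open>(-1)\<^bsup>#J(#J+1)/2\<^esup> / j!\<close>.
\<close>

definition lambda_bracket ::
  "(complex \<Rightarrow> 'v::ab_group_add \<Rightarrow> 'v) \<Rightarrow> nat \<Rightarrow> ('v \<Rightarrow> 'v sdist) \<Rightarrow> 'v \<Rightarrow> 'v \<Rightarrow> 'v lpoly_val" where
  "lambda_bracket scale N Y a b =
     (\<lambda>j J. if J \<subseteq> {1..N} then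
        scale ((- 1) ^ (card J * N) * sigma N J * ((- 1) ^ (card J * (card J + 1) div 2) / fact j))
          (mode N Y a (int j) J b)
      else 0)"

definition deriv_chi :: "nat \<Rightarrow> lpoly \<Rightarrow> lpoly" where
  "deriv_chi i P = (\<lambda>K. if i \<in> K then 0 else smult (grass_sign {i} K) (P (insert i K)))"

text \<open>
  \<open>\<integral>\<^sub>0\<^sup>\<nabla> P d\<Lambda>\<close> applied to \<open>a\<close>.  The polynomial \<open>\<partial>\<^sub>1 \<dots> \<partial>\<^sub>N P\<close> (derivatives in the \<open>\<chi>\<^sup>i\<close>) only
  depends on \<open>\<lambda>\<close>, so it is its component at \<open>\<chi>\<^bsup>{}\<^esup>\<close>;
  and \<open>\<lambda>\<^sup>k\<close> integrates from \<open>0\<close> to \<open>T\<close> to \<open>T\<^bsup>k+1\<^esup> / (k + 1)\<close>.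
\<close>

definition nabla_int ::
  "(complex \<Rightarrow> 'v::comm_monoid_add \<Rightarrow> 'v) \<Rightarrow> nat \<Rightarrow> ('v \<Rightarrow> 'v) \<Rightarrow> lpoly \<Rightarrow> 'v \<Rightarrow> 'v" where
  "nabla_int scale N T P a =
     (let f = foldr deriv_chi [1..<Suc N] P {}
      in \<Sum>k\<le>degree f. scale (coeff f k / of_nat (k + 1)) ((T ^^ (k + 1)) a))"

text \<open>
  \<open>(\<integral>\<^sub>0\<^sup>\<nabla> d\<Lambda> a) F(\<Lambda>)\<close>, computed by expanding \<open>F\<close> in monomials.  The lemma
  \<open>nabla_int_apply_expansion\<close> below shows that every other finite expansion gives the same result.
\<close>

definition nabla_int_apply ::
  "(complex \<Rightarrow> 'v::comm_monoid_add \<Rightarrow> 'v) \<Rightarrow> nat \<Rightarrow> ('v \<Rightarrow> 'v) \<Rightarrow> ('v \<Rightarrow> 'v sdist) \<Rightarrow>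
     'v \<Rightarrow> 'v lpoly_val \<Rightarrow> 'v" where
  "nabla_int_apply scale N T Y a F =
     Sum_any (\<lambda>j. \<Sum>J\<in>Pow {1..N}.
       normal_prod N Y (nabla_int scale N T (lam_monom j J) a) (F j J))"


section \<open>Well-definedness\<close>

text \<open>
  The sums over \<open>j\<close> are taken with \<^const>\<open>Sum_any\<close>, which is \<open>0\<close> by convention on families of
  infinite support; the following facts show that this case does not occur.
\<close>

context susy_vertex_algebra
begin

lemma mode_zero [simp]: "mode N Y a j J 0 = 0"
proof -
  interpret L: Vector_Spaces.linear scale scale "mode N Y a j J"
    unfolding mode_def by (rule Y_operator)
  show ?thesis by (rule L.zero)
qed

lemma modes_vanish: "\<exists>n. \<forall>j\<ge>n. \<forall>J. mode N Y b (int j) J c = 0"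
proof -
  obtain M where M: "\<forall>m<M. \<forall>K. Y b m K c = 0"
    using Y_field by blast
  have "mode N Y b (int j) J c = 0" if "j \<ge> nat (- M)" for j J
    unfolding mode_def using M that by auto
  then show ?thesis by blast
qed

lemma finite_support_modes: "finite {j. mode N Y a (- 2 - int j) I (mode N Y b (int j) J c) \<noteq> 0}"
proof -
  obtain n where "\<forall>j\<ge>n. \<forall>J. mode N Y b (int j) J c = 0"
    using modes_vanish by blast
  then have "{j. mode N Y a (- 2 - int j) I (mode N Y b (int j) J c) \<noteq> 0} \<subseteq> {..<n}"
    by (auto simp: not_less[symmetric])
  then show ?thesis by (rule finite_subset) simp
qed

lemma lambda_bracket_vanish: "\<exists>n. \<forall>j\<ge>n. \<forall>J. lambda_bracket scale N Y b c j J = 0"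
  using modes_vanish[of b c] by (auto simp: lambda_bracket_def)

lemma foldr_deriv_chi:
  "\<exists>s L. L \<subseteq> K \<union> set xs \<and> (\<forall>P. foldr deriv_chi xs P K = smult s (P L))"
proof (induction xs arbitrary: K)
  case Nil
  have "K \<subseteq> K \<union> set [] \<and> (\<forall>P. foldr deriv_chi [] P K = smult 1 (P K))"
    by simp
  then show ?case by blast
next
  case (Cons i xs)
  show ?case
  proof (cases "i \<in> K")
    case True
    then have "K \<subseteq> K \<union> set (i # xs) \<and> (\<forall>P. foldr deriv_chi (i # xs) P K = smult 0 (P K))"
      by (auto simp: deriv_chi_def)
    then show ?thesis by blast
  next
    case False
    obtain s L where "L \<subseteq> insert i K \<union> set xs"
      and "\<forall>P. foldr deriv_chi xs P (insert i K) = smult s (P L)"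
      using Cons.IH[of "insert i K"] by blast
    then have "L \<subseteq> K \<union> set (i # xs) \<and>
        (\<forall>P. foldr deriv_chi (i # xs) P K = smult (grass_sign {i} K * s) (P L))"
      using False by (auto simp: deriv_chi_def)
    then show ?thesis by blast
  qed
qed

lemma nabla_int_apply_expansion:
  assumes R: "finite R"
    and F: "\<And>j J. J \<subseteq> {1..N} \<Longrightarrow> F j J = (\<Sum>r\<in>R. scale (coeff (P r J) j) (e r))"
  shows "nabla_int_apply scale N T Y a F = (\<Sum>r\<in>R. normal_prod N Y (nabla_int scale N T (P r) a) (e r))"
proof -
  obtain s L where "L \<subseteq> {} \<union> set [1..<Suc N]"
    and fold: "\<And>P. foldr deriv_chi [1..<Suc N] P {} = smult s (P L)"
    using foldr_deriv_chi[of "{}" "[1..<Suc N]"] by blast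
  then have L: "L \<subseteq> {1..N}"
    by auto
  define g where "g k = scale (s / of_nat (k + 1)) ((T ^^ (k + 1)) a)" for k
  have int: "nabla_int scale N T Q a = (\<Sum>k\<le>d. scale (coeff (Q L) k) (g k))"
    if "degree (Q L) \<le> d" for Q d
  proof -
    have "nabla_int scale N T Q a = (\<Sum>k\<le>degree (smult s (Q L)). scale (coeff (Q L) k) (g k))"
      unfolding nabla_int_def fold Let_def
      by (simp add: g_def mult.commute del: degree_smult_eq)
    also have "\<dots> = (\<Sum>k\<le>d. scale (coeff (Q L) k) (g k))"
    proof (rule sum.mono_neutral_left)
      show "{..degree (smult s (Q L))} \<subseteq> {..d}"
        using degree_smult_le[of s "Q L"] that by auto
      show "\<forall>k\<in>{..d} - {..degree (smult s (Q L))}. scale (coeff (Q L) k) (g k) = 0"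
      proof
        fix k assume "k \<in> {..d} - {..degree (smult s (Q L))}"
        then have "s * coeff (Q L) k = 0"
          using coeff_eq_0[of "smult s (Q L)" k] by simp
        then show "scale (coeff (Q L) k) (g k) = 0"
          by (auto simp: g_def)
      qed
    qed simp
    finally show ?thesis .
  qed
  have mono: "nabla_int scale N T (lam_monom j J) a = (if J = L then g j else 0)" for j J
  proof (cases "J = L")
    case True
    have "nabla_int scale N T (lam_monom j J) a = (\<Sum>k\<le>j. scale (coeff (lam_monom j J L) k) (g k))"
      by (rule int) (simp add: lam_monom_def True degree_monom_le)
    also have "\<dots> = (\<Sum>k\<le>j. if k = j then g j else 0)"
      by (rule sum.cong) (auto simp: lam_monom_def True)
    finally show ?thesis using True by simp
  next
    case False
    then show ?thesis using int[of "lam_monom j J" 0] by (simp add: lam_monom_def)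
  qed
  interpret R: Vector_Spaces.linear scale scale "normal_prod N Y u" for u
    unfolding normal_prod_def mode_def by (rule Y_operator)
  interpret A: Vector_Spaces.linear scale scale "\<lambda>u. normal_prod N Y u v" for v
    unfolding normal_prod_def mode_def by (rule Y_linear)
  define d where "d = (\<Sum>r\<in>R. degree (P r L))"
  have d: "degree (P r L) \<le> d" if "r \<in> R" for r
    unfolding d_def using R that by (intro member_le_sum) auto
  have "(\<Sum>J\<in>Pow {1..N}. normal_prod N Y (nabla_int scale N T (lam_monom j J) a) (F j J))
      = (\<Sum>J\<in>Pow {1..N}. if J = L then normal_prod N Y (g j) (F j L) else 0)" for j
    by (rule sum.cong) (auto simp: mono A.zero)
  then have "nabla_int_apply scale N T Y a F = Sum_any (\<lambda>j. normal_prod N Y (g j) (F j L))"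
    using L by (simp add: nabla_int_apply_def)
  also have "\<dots> = (\<Sum>j\<le>d. normal_prod N Y (g j) (F j L))"
  proof (rule Sum_any.expand_superset)
    have "F j L = 0" if "j > d" for j
    proof -
      have "coeff (P r L) j = 0" if "r \<in> R" for r
        using le_less_trans[OF d[OF that] \<open>j > d\<close>] by (rule coeff_eq_0)
      then show ?thesis unfolding F[OF L] by simp
    qed
    then show "{j. normal_prod N Y (g j) (F j L) \<noteq> 0} \<subseteq> {..d}"
      by (auto simp: not_less[symmetric] R.zero)
  qed simp
  also have "\<dots> = (\<Sum>j\<le>d. \<Sum>r\<in>R. scale (coeff (P r L) j) (normal_prod N Y (g j) (e r)))"
    by (simp add: F[OF L] R.sum R.scale)
  also have "\<dots> = (\<Sum>r\<in>R. \<Sum>j\<le>d. scale (coeff (P r L) j) (normal_prod N Y (g j) (e r)))"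
    by (rule sum.swap)
  also have "\<dots> = (\<Sum>r\<in>R. normal_prod N Y (nabla_int scale N T (P r) a) (e r))"
    by (rule sum.cong) (simp_all add: int[of "P _" d] d A.sum A.scale)
  finally show ?thesis .
qed

end

end

(*
  At theta = 0 the fields Y(a, Z) form an ordinary vertex superalgebra, and only these components
  occur in the identity.  By Dong's lemma the normally ordered product of Y(a, z) and Y(b, z) is
  local to all fields, so by Goddard's uniqueness theorem it is the field of :ab:.  Comparing the
  constant terms on c gives the first formula.  Uniqueness also gives Y(Ta, z) = d/dz Y(a, z),
  hence a_(-2-j) = (T^(j+1) a)_(-1) / (j+1)!, and the signs in the bracket and the integral cancel
  because N^2 + N(N+1)/2 + N(N-1)/2 is even.
*)

theory Submission
  imports Defs "HOL-Library.Function_Algebras"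
begin

section \<open>Multiplication by differences of variables\<close>

text \<open>Series infinite in both directions have zero divisors: \<open>y - z\<close> kills the
  formal delta function, the sum of all \<open>y^m z^(-1-m)\<close>. A power of \<open>y - z\<close>
  given by locality therefore cannot simply be cancelled; cancelling becomes legitimate once one
  field is applied to the vacuum, because no negative powers of its variable remain. This is why
  fields are compared through their action on the vacuum. For the same reason
  \<open>1/(y - z)\<close> has two different expansions, and normal ordering is built from both. The
  index -2-j comes from the constant term of the normally ordered product. The expansion in |y| >
  |z| contributes the coefficient of \<open>z^k\<close> in Y(a,z) composed with that of
  \<open>z^(-k)\<close> in Y(b,z), for all k \<ge> 0. Its term k = 0 is the product :a:bc::, and the
  terms k \<ge> 1 form the first sum; the other expansion contributes exactly the second
  sum.\<close>

text \<open>
  A series is its family of coefficients; for series in \<open>y, z, x\<close>, in this order, \<open>mult_diff12\<close>,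
  \<open>mult_diff13\<close>, \<open>mult_diff23\<close> multiply by \<open>y - z\<close>, \<open>y - x\<close>, \<open>z - x\<close>.
\<close>

definition mult_diff :: "(int \<Rightarrow> int \<Rightarrow> 'v::ab_group_add) \<Rightarrow> int \<Rightarrow> int \<Rightarrow> 'v" where
  "mult_diff F = (\<lambda>m l. F (m - 1) l - F m (l - 1))"

definition mult_diff12 :: "(int \<Rightarrow> int \<Rightarrow> int \<Rightarrow> 'v::ab_group_add) \<Rightarrow> int \<Rightarrow> int \<Rightarrow> int \<Rightarrow> 'v" where
  "mult_diff12 F = (\<lambda>m l i. F (m - 1) l i - F m (l - 1) i)"

definition mult_diff13 :: "(int \<Rightarrow> int \<Rightarrow> int \<Rightarrow> 'v::ab_group_add) \<Rightarrow> int \<Rightarrow> int \<Rightarrow> int \<Rightarrow> 'v" where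
  "mult_diff13 F = (\<lambda>m l i. F (m - 1) l i - F m l (i - 1))"

definition mult_diff23 :: "(int \<Rightarrow> int \<Rightarrow> int \<Rightarrow> 'v::ab_group_add) \<Rightarrow> int \<Rightarrow> int \<Rightarrow> int \<Rightarrow> 'v" where
  "mult_diff23 F = (\<lambda>m l i. F m (l - 1) i - F m l (i - 1))"

lemma mult_diff12_funpow: "(mult_diff12 ^^ n) F m l i = (mult_diff ^^ n) (\<lambda>m l. F m l i) m l"
  by (induction n arbitrary: m l i) (simp_all add: mult_diff12_def mult_diff_def)

lemma mult_diff13_funpow: "(mult_diff13 ^^ n) F m l i = (mult_diff ^^ n) (\<lambda>m i. F m l i) m i"
  by (induction n arbitrary: m l i) (simp_all add: mult_diff13_def mult_diff_def)

lemma mult_diff23_funpow: "(mult_diff23 ^^ n) F m l i = (mult_diff ^^ n) (F m) l i"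
  by (induction n arbitrary: m l i) (simp_all add: mult_diff23_def mult_diff_def)

lemma additive_funpow:
  fixes f :: "'a::ab_group_add \<Rightarrow> 'a"
  assumes "additive f"
  shows "additive (f ^^ n)"
proof -
  interpret additive f by fact
  show ?thesis
    by (induction n) (simp_all add: additive_def add)
qed

lemma additive_mult_diff: "additive mult_diff"
  by (auto simp: additive_def mult_diff_def fun_eq_iff)

lemma additive_mult_diff12: "additive mult_diff12"
  by (auto simp: additive_def mult_diff12_def fun_eq_iff)

lemma additive_mult_diff13: "additive mult_diff13"
  by (auto simp: additive_def mult_diff13_def fun_eq_iff)

lemma additive_mult_diff23: "additive mult_diff23"
  by (auto simp: additive_def mult_diff23_def fun_eq_iff)

lemma funpow_commute:
  assumes "\<And>x. f (g x) = g (f x)"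
  shows "(f ^^ m) ((g ^^ n) x) = (g ^^ n) ((f ^^ m) x)"
proof -
  have "f ((g ^^ n) x) = (g ^^ n) (f x)" for x
    by (induction n) (simp_all add: assms)
  then show ?thesis
    by (induction m) simp_all
qed

lemma mult_diff12_13: "mult_diff12 (mult_diff13 F) = mult_diff13 (mult_diff12 F)"
  by (simp add: mult_diff12_def mult_diff13_def fun_eq_iff)

lemma mult_diff12_23: "mult_diff12 (mult_diff23 F) = mult_diff23 (mult_diff12 F)"
  by (simp add: mult_diff12_def mult_diff23_def fun_eq_iff)

lemma mult_diff13_23: "mult_diff13 (mult_diff23 F) = mult_diff23 (mult_diff13 F)"
  by (simp add: mult_diff13_def mult_diff23_def fun_eq_iff)

text \<open>A binomial argument: every monomial of degree \<open>i + j\<close> in the commuting maps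
  \<open>P\<close> and \<open>Q\<close> contains \<open>P\<close> at least \<open>i\<close> times or
  \<open>Q\<close> at least \<open>j\<close> times. The induction splits off the innermost factor,
  since \<open>P x\<close> lowers the exponent \<open>i\<close> by one, keeps \<open>j\<close>, and
  symmetrically for \<open>Q x\<close>.\<close>

lemma nilpotent_diff:
  assumes "additive P" "additive Q" "\<And>x. P (Q x) = Q (P x)"
    and "(P ^^ i) x = 0" "(Q ^^ j) x = 0"
  shows "((\<lambda>x. Q x - P x) ^^ (i + j)) x = 0"
  using assms(4,5)
proof (induction "i + j" arbitrary: i j x)
  case 0
  then show ?case by simp
next
  case (Suc n)
  define R where "R = (\<lambda>x. Q x - P x)"
  have "additive R"
    using assms(1,2) by (simp add: R_def additive_def)
  note R = additive_funpow[OF this, of n]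
  have *: "(Q ^^ k) 0 = 0" "(P ^^ k) 0 = 0" for k
    by (simp_all add: additive.zero additive_funpow assms(1,2))
  have P: "(R ^^ n) (P x) = 0"
  proof (cases i)
    case 0
    then have "x = 0" using Suc.prems by simp
    then show ?thesis
      using additive.zero[OF R] additive.zero[OF assms(1)] by simp
  next
    case (Suc i')
    have "(P ^^ i') (P x) = 0"
      using Suc.prems(1) Suc by (simp add: funpow_swap1)
    moreover have "(Q ^^ j) (P x) = 0"
      using funpow_commute[of Q P j 1 x] assms(3) Suc.prems(2) *(2)[of 1] by simp
    ultimately show ?thesis
      using Suc.hyps(1)[of i' j "P x"] Suc.hyps(2) Suc by (simp add: R_def)
  qed
  have Q: "(R ^^ n) (Q x) = 0"
  proof (cases j)
    case 0
    then have "x = 0" using Suc.prems by simp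
    then show ?thesis
      using additive.zero[OF R] additive.zero[OF assms(2)] by simp
  next
    case (Suc j')
    have "(Q ^^ j') (Q x) = 0"
      using Suc.prems(2) Suc by (simp add: funpow_swap1)
    moreover have "(P ^^ i) (Q x) = 0"
      using funpow_commute[of P Q i 1 x] assms(3) Suc.prems(1) *(1)[of 1] by simp
    ultimately show ?thesis
      using Suc.hyps(1)[of i j' "Q x"] Suc.hyps(2) Suc by (simp add: R_def)
  qed
  have "(R ^^ Suc n) x = (R ^^ n) (Q x) - (R ^^ n) (P x)"
    by (simp add: funpow_Suc_right R_def additive.diff[OF R[unfolded R_def]] del: funpow.simps)
  then show ?case
    using P Q Suc.hyps(2) by (simp add: R_def)
qed

lemma mult_diff_funpow_map:
  assumes "additive f"
  shows "(mult_diff ^^ n) (\<lambda>m l. f (F m l)) = (\<lambda>m l. f ((mult_diff ^^ n) F m l))"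
  by (induction n) (simp_all add: mult_diff_def additive.diff[OF assms])

lemma mult_diff_funpow_zero [simp]: "(mult_diff ^^ n) (\<lambda>m l. 0) = (\<lambda>m l. 0)"
  using additive.zero[OF additive_funpow[OF additive_mult_diff]] by (simp add: zero_fun_def)

text \<open>A series killed by \<open>y - z\<close> is constant along the lines where
  \<open>m + l\<close> is fixed. Every such line reaches \<open>l < 0\<close>, where the
  coefficients vanish.\<close>

lemma mult_diff_funpow_cancel:
  assumes "(mult_diff ^^ n) F = (\<lambda>m l. 0)" and "\<And>m l. l < 0 \<Longrightarrow> F m l = 0"
  shows "F m l = 0"
  using assms
proof (induction n arbitrary: m l)
  case 0
  then show ?case by simp
next
  case (Suc n)
  define G where "G = (mult_diff ^^ n) F"
  have neg: "(mult_diff ^^ k) F m l = 0" if "l < 0" for k m l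
    using that
  proof (induction k arbitrary: m l)
    case 0
    then show ?case using Suc.prems(2) by simp
  qed (simp add: mult_diff_def)
  have step: "G (m - 1) l = G m (l - 1)" for m l
    using fun_cong[OF fun_cong[OF Suc.prems(1)], of m l]
    by (simp add: G_def[symmetric]) (simp add: mult_diff_def)
  have G_nat: "G m (int k) = 0" for m k
  proof (induction k arbitrary: m)
    case 0
    then show ?case using step[of "m + 1" 0] neg[of "-1"] by (simp add: G_def)
  next
    case (Suc k)
    then show ?case using step[of "m + 1" "int (Suc k)"] by simp
  qed
  have "G m l = 0" for m l
    using neg[of l n m] G_nat[of m "nat l"] by (cases "l < 0") (simp_all add: G_def)
  then have "(mult_diff ^^ n) F = (\<lambda>m l. 0)"
    by (simp add: G_def fun_eq_iff)
  then show ?case using Suc.IH Suc.prems(2) by blast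
qed


section \<open>Termwise sums\<close>

lemma additive_Sum_any:
  assumes "additive f" "finite {k. g k \<noteq> 0}"
  shows "f (Sum_any g) = Sum_any (\<lambda>k. f (g k))"
proof -
  have "f (Sum_any g) = (\<Sum>k | g k \<noteq> 0. f (g k))"
    by (simp add: Sum_any.expand_set additive.sum[OF assms(1)])
  also have "\<dots> = Sum_any (\<lambda>k. f (g k))"
    by (rule Sum_any.expand_superset[symmetric]) (use assms in \<open>auto simp: additive.zero\<close>)
  finally show ?thesis .
qed

lemma Sum_any_diff:
  fixes g h :: "'b \<Rightarrow> 'a::ab_group_add"
  assumes "finite {k. g k \<noteq> 0}" "finite {k. h k \<noteq> 0}"
  shows "Sum_any (\<lambda>k. g k - h k) = Sum_any g - Sum_any h"
proof -
  have "additive (uminus :: 'a \<Rightarrow> 'a)"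
    by (simp add: additive_def)
  then have "Sum_any (\<lambda>k. - h k) = - Sum_any h"
    using additive_Sum_any[of uminus h] assms(2) by simp
  moreover have "finite {k. - h k \<noteq> 0}"
    using assms(2) by simp
  ultimately show ?thesis
    using Sum_any.distrib[of g "\<lambda>k. - h k"] assms(1) by simp
qed

lemma Sum_any_nat_split:
  assumes "finite {k::nat. g k \<noteq> 0}"
  shows "Sum_any g = g 0 + Sum_any (\<lambda>k. g (Suc k))"
proof -
  obtain n where n: "{k. g k \<noteq> 0} \<subseteq> {..<n}"
    using assms finite_nat_iff_bounded by blast
  have "Sum_any g = (\<Sum>k<Suc n. g k)"
    by (rule Sum_any.expand_superset) (use n in auto)
  also have "\<dots> = g 0 + (\<Sum>k<n. g (Suc k))"
    by (rule sum.lessThan_Suc_shift)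
  also have "(\<Sum>k<n. g (Suc k)) = Sum_any (\<lambda>k. g (Suc k))"
    by (rule Sum_any.expand_superset[symmetric]) (use n in auto)
  finally show ?thesis .
qed

text \<open>With shifts \<open>1 + k\<close> and \<open>- k\<close>, \<open>shift_sum\<close>
  multiplies by the sum of \<open>y^(-1-k) z^k\<close>, which is \<open>1/(y - z)\<close> expanded
  in |y| > |z|. The opposite shifts give \<open>1/(z - y)\<close> expanded in |z| > |y|. Summability
  has to be tracked because \<open>Sum_any\<close> returns 0 on infinite support.\<close>

definition shift_summable where
  "shift_summable f g F \<longleftrightarrow> (\<forall>m l i. finite {k::nat. F (m + f k) (l + g k) i \<noteq> (0::'v::ab_group_add)})"

definition shift_sum ::
  "(nat \<Rightarrow> int) \<Rightarrow> (nat \<Rightarrow> int) \<Rightarrow> (int \<Rightarrow> int \<Rightarrow> int \<Rightarrow> 'v::ab_group_add) \<Rightarrow> int \<Rightarrow> int \<Rightarrow> int \<Rightarrow> 'v" where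
  "shift_sum f g F = (\<lambda>m l i. Sum_any (\<lambda>k. F (m + f k) (l + g k) i))"

lemma finite_support_diff:
  assumes "finite {k. g k \<noteq> (0::'a::ab_group_add)}" "finite {k. h k \<noteq> 0}"
  shows "finite {k. g k - h k \<noteq> 0}"
  by (rule finite_subset[of _ "{k. g k \<noteq> 0} \<union> {k. h k \<noteq> 0}"]) (use assms in auto)

lemma shift_sum_mult_diff13:
  assumes "shift_summable f g F"
  shows "shift_summable f g (mult_diff13 F)"
    and "shift_sum f g (mult_diff13 F) = mult_diff13 (shift_sum f g F)"
proof -
  have fin: "finite {k. F (m + f k - 1) (l + g k) i \<noteq> 0}" "finite {k. F (m + f k) (l + g k) i \<noteq> 0}"
    for m l i
    using assms[unfolded shift_summable_def, rule_format, of "m - 1" l i]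
      assms[unfolded shift_summable_def, rule_format, of m l i]
    by (simp_all add: algebra_simps)
  show "shift_summable f g (mult_diff13 F)"
    unfolding shift_summable_def mult_diff13_def by (intro allI finite_support_diff fin)
  show "shift_sum f g (mult_diff13 F) = mult_diff13 (shift_sum f g F)"
    unfolding shift_sum_def mult_diff13_def
    by (intro ext) (subst Sum_any_diff[OF fin], simp add: algebra_simps)
qed

lemma shift_sum_mult_diff23:
  assumes "shift_summable f g F"
  shows "shift_summable f g (mult_diff23 F)"
    and "shift_sum f g (mult_diff23 F) = mult_diff23 (shift_sum f g F)"
proof -
  have fin: "finite {k. F (m + f k) (l + g k - 1) i \<noteq> 0}" "finite {k. F (m + f k) (l + g k) i \<noteq> 0}"
    for m l i
    using assms[unfolded shift_summable_def, rule_format, of m "l - 1" i]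
      assms[unfolded shift_summable_def, rule_format, of m l i]
    by (simp_all add: algebra_simps)
  show "shift_summable f g (mult_diff23 F)"
    unfolding shift_summable_def mult_diff23_def by (intro allI finite_support_diff fin)
  show "shift_sum f g (mult_diff23 F) = mult_diff23 (shift_sum f g F)"
    unfolding shift_sum_def mult_diff23_def
    by (intro ext) (subst Sum_any_diff[OF fin], simp add: algebra_simps)
qed

text \<open>Powers of \<open>y - x\<close> and \<open>z - x\<close> can be moved inside an expansion
  of \<open>1/(y - z)\<close>, where they meet the commutators that they kill.\<close>

lemma shift_sum_funpow:
  assumes "shift_summable f g F"
  shows "shift_sum f g ((mult_diff13 ^^ n) ((mult_diff23 ^^ k) F)) =
    (mult_diff13 ^^ n) ((mult_diff23 ^^ k) (shift_sum f g F))"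
proof -
  have k: "shift_summable f g ((mult_diff23 ^^ k) F) \<and>
      shift_sum f g ((mult_diff23 ^^ k) F) = (mult_diff23 ^^ k) (shift_sum f g F)"
    by (induction k) (simp_all add: assms shift_sum_mult_diff23)
  then have "shift_summable f g ((mult_diff13 ^^ n) ((mult_diff23 ^^ k) F)) \<and>
      shift_sum f g ((mult_diff13 ^^ n) ((mult_diff23 ^^ k) F)) =
        (mult_diff13 ^^ n) (shift_sum f g ((mult_diff23 ^^ k) F))"
    by (induction n) (simp_all add: shift_sum_mult_diff13)
  with k show ?thesis by simp
qed


section \<open>Local fields and Dong's lemma\<close>

definition is_field :: "(int \<Rightarrow> 'v \<Rightarrow> 'v::zero) \<Rightarrow> bool" where
  "is_field A \<longleftrightarrow> (\<forall>v. \<exists>M. \<forall>m<M. A m v = 0)"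

lemma is_field_finite:
  assumes "is_field A"
  shows "finite {k::nat. A (m - int k) v \<noteq> 0}"
proof -
  obtain M where M: "\<And>m. m < M \<Longrightarrow> A m v = 0"
    using assms by (auto simp: is_field_def)
  have "k \<le> nat (m - M)" if "A (m - int k) v \<noteq> 0" for k
    using M[of "m - int k"] that by linarith
  then have "{k::nat. A (m - int k) v \<noteq> 0} \<subseteq> {..nat (m - M)}"
    by auto
  then show ?thesis by (rule finite_subset) simp
qed

locale formal_fields = vector_space scale
  for scale :: "'a::field \<Rightarrow> 'b::ab_group_add \<Rightarrow> 'b"
begin

lemma additive_scale: "additive (scale e)"
  by (simp add: additive_def scale_right_distrib)

lemma additive_linear: "Vector_Spaces.linear scale scale f \<Longrightarrow> additive f"
  by (simp add: additive_def linear_iff_module_hom module_hom.add)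

lemma linear_scale: "Vector_Spaces.linear scale scale f \<Longrightarrow> f (scale e x) = scale e (f x)"
  by (simp add: linear_iff_module_hom module_hom.scale)

text \<open>The super sign is an arbitrary scalar \<open>e\<close>, which keeps parities out of
  Dong's lemma. The exponent \<open>n\<close> is uniform in the vector \<open>v\<close>.\<close>

definition local_fields :: "'a \<Rightarrow> (int \<Rightarrow> 'b \<Rightarrow> 'b) \<Rightarrow> (int \<Rightarrow> 'b \<Rightarrow> 'b) \<Rightarrow> bool" where
  "local_fields e A B \<longleftrightarrow>
     (\<exists>n. \<forall>v. (mult_diff ^^ n) (\<lambda>m l. A m (B l v) - scale e (B l (A m v))) = (\<lambda>m l. 0))"

text \<open>
  The coefficient of \<open>y\<^sup>m z\<^sup>l\<close> in \<open>(y - z)\<^sup>-\<^sup>1 A(y) B(z) - e (y - z)\<^sup>-\<^sup>1 B(z) A(y)\<close>, where the first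
  \<open>(y - z)\<^sup>-\<^sup>1\<close> is expanded in \<open>|y| > |z|\<close> and the second one in \<open>|z| > |y|\<close>.  Its residue in \<open>y\<close> is
  the normally ordered product.
\<close>

definition pole_prod :: "'a \<Rightarrow> (int \<Rightarrow> 'b \<Rightarrow> 'b) \<Rightarrow> (int \<Rightarrow> 'b \<Rightarrow> 'b) \<Rightarrow> int \<Rightarrow> int \<Rightarrow> 'b \<Rightarrow> 'b" where
  "pole_prod e A B m l v =
     Sum_any (\<lambda>k. A (m + 1 + int k) (B (l - int k) v))
     + scale e (Sum_any (\<lambda>k. B (l + 1 + int k) (A (m - int k) v)))"

definition normal_order :: "'a \<Rightarrow> (int \<Rightarrow> 'b \<Rightarrow> 'b) \<Rightarrow> (int \<Rightarrow> 'b \<Rightarrow> 'b) \<Rightarrow> int \<Rightarrow> 'b \<Rightarrow> 'b" where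
  "normal_order e A B = pole_prod e A B (- 1)"

lemma finite_support_comp:
  assumes "\<And>m. Vector_Spaces.linear scale scale (A m)" "is_field B"
  shows "finite {k::nat. A (f k) (B (l - int k) v) \<noteq> 0}"
  by (rule finite_subset[OF _ is_field_finite[OF assms(2), of l v]])
    (use additive.zero[OF additive_linear[OF assms(1)]] in auto)

text \<open>The factor \<open>y - z\<close> cancels both expansions of its inverse: in each of the
  two sums the coefficients telescope and only the term k = 0 survives.\<close>

lemma mult_diff_pole_prod:
  assumes A: "\<And>m. Vector_Spaces.linear scale scale (A m)" "is_field A"
    and B: "\<And>m. Vector_Spaces.linear scale scale (B m)" "is_field B"
  shows "mult_diff (\<lambda>m l. pole_prod e A B m l v) = (\<lambda>m l. A m (B l v) - scale e (B l (A m v)))"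
proof (intro ext)
  fix m l
  have 1: "Sum_any (\<lambda>k. A (m + int k) (B (l - int k) v)) =
      A m (B l v) + Sum_any (\<lambda>k. A (m + 1 + int k) (B (l - 1 - int k) v))"
    by (subst Sum_any_nat_split[OF finite_support_comp[OF A(1) B(2)]]) (simp add: algebra_simps)
  have 2: "Sum_any (\<lambda>k. B (l + int k) (A (m - int k) v)) =
      B l (A m v) + Sum_any (\<lambda>k. B (l + 1 + int k) (A (m - 1 - int k) v))"
    by (subst Sum_any_nat_split[OF finite_support_comp[OF B(1) A(2)]]) (simp add: algebra_simps)
  show "mult_diff (\<lambda>m l. pole_prod e A B m l v) m l = A m (B l v) - scale e (B l (A m v))"
    by (simp add: mult_diff_def pole_prod_def 1 2 scale_right_distrib)
qed

text \<open>By the Leibniz rule [AB, C] = A [B, C] + [A, C] B. The first summand is killed by a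
  power of \<open>z - x\<close>, the second by a power of \<open>y - x\<close>, so the product of
  the two powers kills both. The same holds for BA.\<close>

lemma mult_diff_comp_commutator:
  assumes A: "\<And>m. Vector_Spaces.linear scale scale (A m)"
    and B: "\<And>m. Vector_Spaces.linear scale scale (B m)"
    and C: "\<And>m. Vector_Spaces.linear scale scale (C m)"
    and AC: "\<And>v. (mult_diff ^^ n) (\<lambda>m l. A m (C l v) - scale e1 (C l (A m v))) = (\<lambda>m l. 0)"
    and BC: "\<And>v. (mult_diff ^^ k) (\<lambda>m l. B m (C l v) - scale e2 (C l (B m v))) = (\<lambda>m l. 0)"
  shows "(mult_diff13 ^^ n) ((mult_diff23 ^^ k)
      (\<lambda>m l i. A m (B l (C i v)) - scale (e1 * e2) (C i (A m (B l v))))) = 0"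
    and "(mult_diff13 ^^ n) ((mult_diff23 ^^ k)
      (\<lambda>m l i. B l (A m (C i v)) - scale (e1 * e2) (C i (B l (A m v))))) = 0"
proof -
  let ?P1 = "(mult_diff13 ^^ n) :: (int \<Rightarrow> int \<Rightarrow> int \<Rightarrow> 'b) \<Rightarrow> int \<Rightarrow> int \<Rightarrow> int \<Rightarrow> 'b"
  let ?P2 = "(mult_diff23 ^^ k) :: (int \<Rightarrow> int \<Rightarrow> int \<Rightarrow> 'b) \<Rightarrow> int \<Rightarrow> int \<Rightarrow> int \<Rightarrow> 'b"
  let ?F = "\<lambda>m l i. A m (B l (C i v)) - scale (e1 * e2) (C i (A m (B l v)))"
  let ?G = "\<lambda>m l i. B l (A m (C i v)) - scale (e1 * e2) (C i (B l (A m v)))"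
  have P1: "additive ?P1" and P2: "additive ?P2"
    by (simp_all add: additive_funpow additive_mult_diff13 additive_mult_diff23)
  have comm: "?P1 (?P2 F) = ?P2 (?P1 F)" for F :: "int \<Rightarrow> int \<Rightarrow> int \<Rightarrow> 'b"
    by (rule funpow_commute) (rule mult_diff13_23)
  have kill: "?P1 (?P2 (F + G)) = 0" if "?P1 F = 0" "?P2 G = 0" for F G
    using that comm[of F] by (simp add: additive.add[OF P1] additive.add[OF P2]
        additive.zero[OF P1] additive.zero[OF P2])
  note lin = linear_scale[OF A] linear_scale[OF B] linear_scale[OF C]
    additive.diff[OF additive_linear[OF A]] additive.diff[OF additive_linear[OF B]]
  have "?F = (\<lambda>m l i. scale e2 (A m (C i (B l v)) - scale e1 (C i (A m (B l v)))))
      + (\<lambda>m l i. A m (B l (C i v) - scale e2 (C i (B l v))))"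
    by (simp add: fun_eq_iff lin scale_right_diff_distrib mult.commute)
  moreover have "?P1 (\<lambda>m l i. scale e2 (A m (C i (B l v)) - scale e1 (C i (A m (B l v))))) = 0"
    by (simp add: fun_eq_iff mult_diff13_funpow mult_diff_funpow_map[OF additive_scale] AC)
  moreover have "?P2 (\<lambda>m l i. A m (B l (C i v) - scale e2 (C i (B l v)))) = 0"
    by (simp add: fun_eq_iff mult_diff23_funpow mult_diff_funpow_map[OF additive_linear[OF A]] BC
        additive.zero[OF additive_linear[OF A]])
  ultimately show "?P1 (?P2 ?F) = 0"
    using kill by presburger
  have "?G = (\<lambda>m l i. B l (A m (C i v) - scale e1 (C i (A m v))))
      + (\<lambda>m l i. scale e1 (B l (C i (A m v)) - scale e2 (C i (B l (A m v)))))"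
    by (simp add: fun_eq_iff lin scale_right_diff_distrib)
  moreover have "?P2 (\<lambda>m l i. scale e1 (B l (C i (A m v)) - scale e2 (C i (B l (A m v))))) = 0"
    by (simp add: fun_eq_iff mult_diff23_funpow mult_diff_funpow_map[OF additive_scale] BC)
  moreover have "?P1 (\<lambda>m l i. B l (A m (C i v) - scale e1 (C i (A m v)))) = 0"
    by (simp add: fun_eq_iff mult_diff13_funpow mult_diff_funpow_map[OF additive_linear[OF B]] AC
        additive.zero[OF additive_linear[OF B]])
  ultimately show "?P1 (?P2 ?G) = 0"
    using kill by presburger
qed

text \<open>As \<open>C\<close> acts termwise on the finite sums, the commutator arises from [AB, C]
  and [BA, C] through the same two expansions of the pole.\<close>

lemma pole_prod_commutator:
  assumes A: "\<And>m. Vector_Spaces.linear scale scale (A m)" "is_field A"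
    and B: "\<And>m. Vector_Spaces.linear scale scale (B m)" "is_field B"
    and C: "\<And>m. Vector_Spaces.linear scale scale (C m)"
  shows "pole_prod e A B m l (C i v) - scale d (C i (pole_prod e A B m l v)) =
      shift_sum (\<lambda>k. 1 + int k) (\<lambda>k. - int k)
        (\<lambda>m l i. A m (B l (C i v)) - scale d (C i (A m (B l v)))) m l i
      + scale e (shift_sum (\<lambda>k. - int k) (\<lambda>k. 1 + int k)
        (\<lambda>m l i. B l (A m (C i v)) - scale d (C i (B l (A m v)))) m l i)"
proof -
  have dC: "additive (\<lambda>x. scale d (C i x))"
    using additive_linear[OF C, of i] by (simp add: additive_def scale_right_distrib)
  have fin: "finite {k. scale d (C i (h k)) \<noteq> 0}" if "finite {k::nat. h k \<noteq> 0}" for h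
    by (rule finite_subset[OF _ that]) (use additive.zero[OF dC] in auto)
  have "Sum_any (\<lambda>k. h k - scale d (C i (h' k))) = Sum_any h - scale d (C i (Sum_any h'))"
    if "finite {k::nat. h k \<noteq> 0}" "finite {k::nat. h' k \<noteq> 0}" for h h'
    using Sum_any_diff[OF that(1) fin[OF that(2)]] additive_Sum_any[OF dC that(2)] by simp
  note * = this[OF finite_support_comp[OF A(1) B(2)] finite_support_comp[OF A(1) B(2)]]
    this[OF finite_support_comp[OF B(1) A(2)] finite_support_comp[OF B(1) A(2)]]
  show ?thesis
    unfolding pole_prod_def shift_sum_def
    by (simp add: add.assoc[symmetric] * additive.add[OF additive_linear[OF C]] linear_scale[OF C]
        scale_right_distrib scale_right_diff_distrib mult.commute)
qed

text \<open>
  Writing \<open>K(y,z,x)\<close> for the commutator of \<open>pole_prod\<close> with \<open>C(x)\<close>, a power of \<open>y - z\<close> kills \<open>K\<close>,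
  and so does a product of powers of \<open>y - x\<close> and \<open>z - x\<close>; as \<open>z - x = (y - x) - (y - z)\<close>, a power of
  \<open>z - x\<close> kills \<open>K\<close>.
\<close>

lemma Dong:
  assumes A: "\<And>m. Vector_Spaces.linear scale scale (A m)" "is_field A"
    and B: "\<And>m. Vector_Spaces.linear scale scale (B m)" "is_field B"
    and C: "\<And>m. Vector_Spaces.linear scale scale (C m)"
    and "local_fields e A B" "local_fields e1 A C" "local_fields e2 B C"
  shows "local_fields (e1 * e2) (normal_order e A B) C"
proof -
  obtain n where AB: "\<And>v. (mult_diff ^^ n) (\<lambda>m l. A m (B l v) - scale e (B l (A m v))) = (\<lambda>m l. 0)"
    using assms(6) by (auto simp: local_fields_def)
  obtain n1 where AC: "\<And>v. (mult_diff ^^ n1) (\<lambda>m l. A m (C l v) - scale e1 (C l (A m v))) = (\<lambda>m l. 0)"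
    using assms(7) by (auto simp: local_fields_def)
  obtain n2 where BC: "\<And>v. (mult_diff ^^ n2) (\<lambda>m l. B m (C l v) - scale e2 (C l (B m v))) = (\<lambda>m l. 0)"
    using assms(8) by (auto simp: local_fields_def)
  define d where "d = e1 * e2"
  \<comment> \<open>One factor \<open>y - z\<close> removes the pole and \<open>n\<close> more use
    the locality of \<open>A\<close> and \<open>B\<close>, hence \<open>Suc n\<close>. The binomial
    argument adds \<open>n1\<close>, and \<open>n2\<close> powers of \<open>z - x\<close> are spent
    beforehand.\<close>
  have "(mult_diff ^^ (Suc n + n1 + n2))
      (\<lambda>l i. normal_order e A B l (C i v) - scale d (C i (normal_order e A B l v))) = (\<lambda>m l. 0)" for v
  proof -
    define K where "K = (\<lambda>m l i. pole_prod e A B m l (C i v) - scale d (C i (pole_prod e A B m l v)))"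
    let ?P1 = "mult_diff13 ^^ n1" and ?P2 = "mult_diff23 ^^ n2" and ?P = "mult_diff12 ^^ Suc n"
    have P1: "additive ?P1" and P2: "additive ?P2"
      by (simp_all add: additive_funpow additive_mult_diff13 additive_mult_diff23)
    have dC: "additive (\<lambda>x. scale d (C i x))" for i
      using additive_linear[OF C, of i] by (simp add: additive_def scale_right_distrib)
    have "?P K m l i = (mult_diff ^^ Suc n) (\<lambda>m l. pole_prod e A B m l (C i v)) m l
        - (mult_diff ^^ Suc n) (\<lambda>m l. scale d (C i (pole_prod e A B m l v))) m l" for m l i
      using additive.diff[OF additive_funpow[OF additive_mult_diff, of "Suc n"],
          of "\<lambda>m l. pole_prod e A B m l (C i v)" "\<lambda>m l. scale d (C i (pole_prod e A B m l v))"]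
      unfolding mult_diff12_funpow by (simp add: K_def fun_diff_def)
    moreover have "(mult_diff ^^ Suc n) (\<lambda>m l. pole_prod e A B m l u) = (\<lambda>m l. 0)" for u
      unfolding funpow_Suc_right o_def mult_diff_pole_prod[OF A B] by (rule AB)
    ultimately have PK: "?P K = 0"
      unfolding mult_diff_funpow_map[OF dC] by (simp add: fun_eq_iff additive.zero[OF dC])
    define F where "F = (\<lambda>m l i. A m (B l (C i v)) - scale d (C i (A m (B l v))))"
    define G where "G = (\<lambda>m l i. B l (A m (C i v)) - scale d (C i (B l (A m v))))"
    let ?SF = "shift_sum (\<lambda>k. 1 + int k) (\<lambda>k. - int k) F"
    let ?SG = "shift_sum (\<lambda>k. - int k) (\<lambda>k. 1 + int k) G"
    have finC: "finite {k::nat. scale d (C i (h k)) \<noteq> 0}" if "finite {k. h k \<noteq> 0}" for h i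
      by (rule finite_subset[OF _ that]) (use additive.zero[OF dC] in auto)
    have "shift_summable (\<lambda>k. 1 + int k) (\<lambda>k. - int k) F"
      unfolding shift_summable_def F_def add_uminus_conv_diff
      by (intro allI finite_support_diff finC finite_support_comp A B)
    moreover have "shift_summable (\<lambda>k. - int k) (\<lambda>k. 1 + int k) G"
      unfolding shift_summable_def G_def add_uminus_conv_diff
      by (intro allI finite_support_diff finC finite_support_comp A B)
    ultimately have SF: "?P1 (?P2 ?SF) = 0" and SG: "?P1 (?P2 ?SG) = 0"
      using mult_diff_comp_commutator[of A B C, OF A(1) B(1) C AC BC, of v]
      by (simp_all add: shift_sum_funpow[symmetric] F_def G_def d_def)
        (simp_all add: shift_sum_def fun_eq_iff)
    have "?P1 (?P2 (\<lambda>m l i. scale e (?SG m l i))) = (\<lambda>m l i. scale e (?P1 (?P2 ?SG) m l i))"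
      by (simp add: fun_eq_iff mult_diff13_funpow mult_diff23_funpow
          mult_diff_funpow_map[OF additive_scale])
    moreover have "K = ?SF + (\<lambda>m l i. scale e (?SG m l i))"
      unfolding K_def F_def G_def plus_fun_def
      by (intro ext) (rule pole_prod_commutator[OF A B C])
    ultimately have QK: "?P1 (?P2 K) = 0"
      by (simp add: additive.add[OF P1] additive.add[OF P2] SF SG) (simp add: fun_eq_iff)
    \<comment> \<open>The binomial argument is applied to \<open>?P2 K\<close>, which is killed by
      powers of both \<open>y - z\<close> and \<open>y - x\<close>.\<close>
    have "?P (?P2 K) = ?P2 (?P K)"
      by (rule funpow_commute) (rule mult_diff12_23)
    then have "?P (?P2 K) = 0"
      by (simp only: PK additive.zero[OF P2])
    from nilpotent_diff[OF additive_mult_diff12 additive_mult_diff13 mult_diff12_13 this QK]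
    have "((\<lambda>K. mult_diff13 K - mult_diff12 K) ^^ (Suc n + n1)) (?P2 K) = 0" .
    moreover have "(\<lambda>K. mult_diff13 K - mult_diff12 K) =
        (mult_diff23 :: (int \<Rightarrow> int \<Rightarrow> int \<Rightarrow> 'b) \<Rightarrow> _)"
      by (simp add: fun_eq_iff mult_diff12_def mult_diff13_def mult_diff23_def)
    ultimately have "(mult_diff23 ^^ (Suc n + n1 + n2)) K = 0"
      by (simp only: funpow_add o_def)
    \<comment> \<open>Multiplication by \<open>z - x\<close> does not touch \<open>y\<close>, so the
      residue in \<open>y\<close> may be taken now.\<close>
    then have "(mult_diff23 ^^ (Suc n + n1 + n2)) K (- 1) l i = 0" for l i
      by simp
    then show ?thesis
      unfolding mult_diff23_funpow by (simp only: K_def normal_order_def fun_eq_iff simp_thms)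
  qed
  then show ?thesis
    unfolding local_fields_def d_def by blast
qed

section \<open>Derivatives of local fields and uniqueness of fields\<close>

definition field_deriv :: "(int \<Rightarrow> 'b \<Rightarrow> 'b) \<Rightarrow> int \<Rightarrow> 'b \<Rightarrow> 'b" where
  "field_deriv A = (\<lambda>m v. scale (of_int (m + 1)) (A (m + 1) v))"

text \<open>Differentiating in \<open>y\<close> costs one more factor, because (y - z) dF/dy = d/dy
  ((y - z) F) - F.\<close>

lemma mult_diff_funpow_deriv:
  assumes "(mult_diff ^^ n) F = (\<lambda>m l. 0)"
  shows "(mult_diff ^^ Suc n) (\<lambda>m l. scale (of_int (m + 1)) (F (m + 1) l)) = (\<lambda>m l. 0)"
  using assms
proof (induction n arbitrary: F)
  case 0
  then show ?case by (simp add: mult_diff_def)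
next
  case (Suc n)
  define E where "E = (\<lambda>F::int \<Rightarrow> int \<Rightarrow> 'b. \<lambda>m l. scale (of_int (m + 1)) (F (m + 1) l))"
  have comm: "mult_diff (E F) = E (mult_diff F) - F"
    by (simp add: fun_eq_iff mult_diff_def E_def scale_left_distrib scale_left_diff_distrib
        scale_right_diff_distrib)
  have "(mult_diff ^^ Suc (Suc n)) (E F) = (mult_diff ^^ Suc n) (E (mult_diff F)) - (mult_diff ^^ Suc n) F"
    unfolding funpow_Suc_right[of "Suc n"] o_def comm
    by (rule additive.diff[OF additive_funpow[OF additive_mult_diff]])
  moreover have "(mult_diff ^^ n) (mult_diff F) = (\<lambda>m l. 0)"
    using Suc.prems by (simp only: funpow_Suc_right o_def)
  ultimately show ?case
    using Suc.IH[of "mult_diff F"] Suc.prems by (simp only: E_def) (simp add: fun_eq_iff)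
qed

lemma local_fields_deriv:
  assumes C: "\<And>m. Vector_Spaces.linear scale scale (C m)" and "local_fields e A C"
  shows "local_fields e (field_deriv A) C"
proof -
  obtain n where n: "\<And>v. (mult_diff ^^ n) (\<lambda>m l. A m (C l v) - scale e (C l (A m v))) = (\<lambda>m l. 0)"
    using assms(2) by (auto simp: local_fields_def)
  have "(mult_diff ^^ Suc n) (\<lambda>m l. field_deriv A m (C l v) - scale e (C l (field_deriv A m v)))
      = (\<lambda>m l. 0)" for v
    using mult_diff_funpow_deriv[OF n[of v]]
    by (simp only: field_deriv_def linear_scale[OF C] scale_right_diff_distrib scale_left_commute)
  then show ?thesis unfolding local_fields_def by blast
qed

lemma mult_diff_funpow_mono:
  assumes "(mult_diff ^^ n) (F::int \<Rightarrow> int \<Rightarrow> 'b) = (\<lambda>m l. 0)" "n \<le> k"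
  shows "(mult_diff ^^ k) F = (\<lambda>m l. 0)"
proof -
  have "(mult_diff ^^ k) F = (mult_diff ^^ (k - n)) ((mult_diff ^^ n) F)"
    using assms(2) by (metis comp_apply funpow_add le_add_diff_inverse2)
  then show ?thesis by (simp add: assms(1))
qed

text \<open>Up to a power of \<open>y - x\<close>, both D(y) C(x) vac and D'(y) C(x) vac equal e
  C(x) D(y) vac. Since C(x) vac has no negative powers of \<open>x\<close>, the power can be
  cancelled; the constant term in \<open>x\<close> is the claim.\<close>

lemma Goddard_uniqueness:
  assumes C: "\<And>m v. m < 0 \<Longrightarrow> C m vac = 0" "\<And>m. Vector_Spaces.linear scale scale (C m)"
    and lin: "\<And>m. additive (D m)" "\<And>m. additive (D' m)"
    and "local_fields e D C" "local_fields e D' C"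
    and eq: "\<And>m. D m vac = D' m vac"
  shows "D m (C 0 vac) = D' m (C 0 vac)"
proof -
  define F where "F = (\<lambda>m l. D m (C l vac))"
  define G where "G = (\<lambda>m l. D' m (C l vac))"
  define X where "X = (\<lambda>m l. scale e (C l (D m vac)))"
  have addn: "additive (mult_diff ^^ n)" for n
    by (rule additive_funpow[OF additive_mult_diff])
  obtain n where n: "(mult_diff ^^ n) (F - X) = (\<lambda>m l. 0)"
    using assms(5) by (auto simp: local_fields_def F_def X_def fun_diff_def)
  obtain n' where n': "(mult_diff ^^ n') (G - X) = (\<lambda>m l. 0)"
    using assms(6) by (auto simp: local_fields_def G_def X_def eq fun_diff_def)
  have "F - G = (F - X) - (G - X)" by simp
  then have "(mult_diff ^^ max n n') (F - G) =
      (mult_diff ^^ max n n') (F - X) - (mult_diff ^^ max n n') (G - X)"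
    using additive.diff[OF addn] by metis
  also have "\<dots> = (\<lambda>m l. 0)"
    using mult_diff_funpow_mono[OF n, of "max n n'"] mult_diff_funpow_mono[OF n', of "max n n'"]
    by (simp add: fun_eq_iff)
  finally have "(F - G) m 0 = 0"
    by (rule mult_diff_funpow_cancel)
      (simp add: F_def G_def C additive.zero[OF lin(1)] additive.zero[OF lin(2)])
  then show ?thesis by (simp add: F_def G_def)
qed

end


section \<open>The fields \<open>Y(a, z)\<close> at \<open>\<theta> = 0\<close>\<close>

context susy_vertex_algebra
begin

sublocale formal_fields scale
  by unfold_locales

definition body :: "'v \<Rightarrow> int \<Rightarrow> 'v \<Rightarrow> 'v" where
  "body a = (\<lambda>m. Y a m {})"

lemma body_linear: "Vector_Spaces.linear scale scale (body a m)"
  by (simp add: body_def Y_operator)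

lemma body_additive: "additive (body a m)"
  by (rule additive_linear[OF body_linear])

lemma body_field: "is_field (body a)"
  using Y_field by (fastforce simp: is_field_def body_def)

lemma body_vacuum: "m < 0 \<Longrightarrow> body a m vac = 0"
  and body_creation: "body a 0 vac = a"
  by (simp_all add: body_def Y_vacuum Y_creation)

lemma body_parity:
  "a \<in> homog V0 V1 p \<Longrightarrow> v \<in> homog V0 V1 q \<Longrightarrow> body a m v \<in> homog V0 V1 (p + q)"
  using Y_parity[of a p v q "{}"] by (simp add: body_def)

lemma mode_eq_body: "mode N Y a j {1..N} = body a (- 1 - j)"
  and normal_prod_eq_body: "normal_prod N Y a = body a 0"
  by (simp_all add: mode_def normal_prod_def body_def fun_eq_iff)

lemma body_translation:
  assumes "a \<in> homog V0 V1 p"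
  shows "T (body a m v) - body a m (T v) = scale (of_int (m + 1)) (body a (m + 1) v)"
  using fun_cong[OF fun_cong[OF fun_cong[OF T_translation[OF assms], of m], of "{}"], of v]
  by (simp add: scomm_op_def deriv_z_def body_def)

text \<open>Multiplication by \<open>z - w\<close> acts within each component of the odd variables.
  In the component without odd variables all reordering signs are 1, and only the parity sign of the
  two states remains.\<close>

lemma body_local:
  assumes "a \<in> homog V0 V1 p" "b \<in> homog V0 V1 q"
  shows "local_fields ((- 1) ^ (p * q)) (body a) (body b)"
proof -
  have slice: "(mult_z_minus_w ^^ n) F m K l L v = (mult_diff ^^ n) (\<lambda>m l. F m K l L v) m l"
    for n m l K L v and F :: "'v sdist2"
    by (induction n arbitrary: m l) (simp_all add: mult_z_minus_w_def mult_diff_def)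
  obtain n where "(mult_z_minus_w ^^ n) (scomm scale p q (Y a) (Y b)) = (\<lambda>m K n L v. 0)"
    using locality[OF assms] by blast
  then have "(mult_diff ^^ n) (\<lambda>m l. scomm scale p q (Y a) (Y b) m {} l {} v) = (\<lambda>m l. 0)" for v
    by (intro ext) (simp flip: slice)
  then show ?thesis
    unfolding local_fields_def by (auto simp: scomm_def prod_ZW_def prod_WZ_def body_def)
qed

text \<open>The relations are the coefficients of T f(z) = f'(z); in characteristic zero they
  determine the series from its constant term.\<close>

lemma translation_covariant_eq:
  assumes neg: "\<And>m. m < 0 \<Longrightarrow> f m = 0" "\<And>m. m < 0 \<Longrightarrow> g m = 0" and "f 0 = g 0"
    and T: "\<And>k. T (f (int k)) = scale (of_nat (Suc k)) (f (int k + 1))"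
      "\<And>k. T (g (int k)) = scale (of_nat (Suc k)) (g (int k + 1))"
  shows "f m = g m"
proof -
  have "f (int k) = g (int k)" for k
  proof (induction k)
    case 0
    then show ?case using assms(3) by simp
  next
    case (Suc k)
    then have "scale (of_nat (Suc k)) (f (int k + 1)) = scale (of_nat (Suc k)) (g (int k + 1))"
      by (simp only: T[symmetric])
    then show ?case
      using of_nat_neq_0[of k, where 'a = complex]
      by (simp only: scale_left_imp_eq scale_cancel_left) (simp add: add.commute)
  qed
  from this[of "nat m"] show ?thesis
    using neg by (cases "m < 0") simp_all
qed

lemma body_translation_vac:
  assumes "a \<in> homog V0 V1 p"
  shows "T (body a m vac) = scale (of_int (m + 1)) (body a (m + 1) vac)"
  using body_translation[OF assms, of m vac] by (simp add: T_vacuum additive.zero[OF body_additive])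

text \<open>Covariance of \<open>D\<close> is requested on the vacuum alone, which for a normally
  ordered product reduces to an identity between finite sums.\<close>

lemma body_unique:
  assumes D: "\<And>m. additive (D m)" "\<And>m. m < 0 \<Longrightarrow> D m vac = 0" "D 0 vac = d"
    and d: "d \<in> homog V0 V1 p" and c: "c \<in> homog V0 V1 q"
    and "local_fields ((- 1) ^ (p * q)) D (body c)"
    and T: "\<And>k. T (D (int k) vac) = scale (of_nat (Suc k)) (D (int k + 1) vac)"
  shows "body d m c = D m c"
proof -
  have "D m vac = body d m vac" for m
    by (rule translation_covariant_eq[where f = "\<lambda>m. D m vac"])
      (use D T body_translation_vac[OF d] in
        \<open>simp_all add: body_vacuum body_creation add.commute\<close>)
  from Goddard_uniqueness[of "body c" vac D "body d", OF body_vacuum body_linear D(1) body_additive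
      assms(6) body_local[OF d c] this]
  show ?thesis by (simp add: body_creation)
qed

lemma body_T:
  assumes a: "a \<in> homog V0 V1 p" and c: "c \<in> homog V0 V1 q"
  shows "body (T a) m c = scale (of_int (m + 1)) (body a (m + 1) c)"
proof -
  have "body (T a) m c = field_deriv (body a) m c"
  proof (rule body_unique[OF _ _ _ T_even[OF a] c])
    show "additive (field_deriv (body a) m)" for m
      using body_additive[of a] by (simp add: additive_def field_deriv_def scale_right_distrib)
    \<comment> \<open>At \<open>m = - 1\<close> the coefficient \<open>body a 0 vac\<close> is
      \<open>a\<close> itself, but its factor \<open>m + 1\<close> is 0.\<close>
    show "field_deriv (body a) m vac = 0" if "m < 0" for m
      using that body_vacuum[of "m + 1" a] by (cases "m = - 1") (simp_all add: field_deriv_def)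
    show "field_deriv (body a) 0 vac = T a"
      using body_translation_vac[OF a, of 0] by (simp add: field_deriv_def body_creation)
    show "local_fields ((- 1) ^ (p * q)) (field_deriv (body a)) (body c)"
      by (rule local_fields_deriv[OF body_linear body_local[OF a c]])
    show "T (field_deriv (body a) (int k) vac) =
        scale (of_nat (Suc k)) (field_deriv (body a) (int k + 1) vac)" for k
      using body_translation_vac[OF a, of "int k + 1"]
      by (simp add: field_deriv_def linear_scale[OF T_linear] add_ac)
  qed
  then show ?thesis by (simp add: field_deriv_def)
qed

lemma T_funpow_homog: "a \<in> homog V0 V1 p \<Longrightarrow> (T ^^ k) a \<in> homog V0 V1 p"
  by (induction k) (simp_all add: T_even)

text \<open>The Pochhammer symbol is the factor from differentiating \<open>z^(m+k)\<close>
  \<open>k\<close> times; at \<open>m = 0\<close> it equals k!.\<close>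

lemma body_T_funpow:
  assumes a: "a \<in> homog V0 V1 p" and c: "c \<in> homog V0 V1 q"
  shows "body ((T ^^ k) a) m c = scale (pochhammer (of_int (m + 1)) k) (body a (m + int k) c)"
proof (induction k arbitrary: m)
  case (Suc k)
  show ?case
    using body_T[OF T_funpow_homog[OF a, of k] c, of m] Suc.IH[of "m + 1"]
    by (simp add: pochhammer_rec add_ac)
qed simp

lemma body_normal_prod:
  assumes a: "a \<in> homog V0 V1 p" and b: "b \<in> homog V0 V1 q" and c: "c \<in> homog V0 V1 r"
  shows "body (normal_prod N Y a b) m c = normal_order ((- 1) ^ (p * q)) (body a) (body b) m c"
proof -
  define D where "D = normal_order ((- 1) ^ (p * q)) (body a) (body b)"
  have fin: "finite {k::nat. body a (f k) (body b (m - int k) v) \<noteq> 0}" for a b f m v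
    by (rule finite_support_comp) (rule body_linear body_field)+
  have D_vac: "D m vac = Sum_any (\<lambda>k. body a (int k) (body b (m - int k) vac))" for m
  proof -
    \<comment> \<open>The second half of \<open>pole_prod\<close> applies these coefficients of
      Y(a,z) to the vacuum and therefore vanishes.\<close>
    have "body a (- 1 - int k) vac = 0" for k
      by (rule body_vacuum) simp
    then show ?thesis
      by (simp add: D_def normal_order_def pole_prod_def additive.zero[OF body_additive])
  qed
  have D_neg: "D m vac = 0" if "m < 0" for m
    using that by (simp add: D_vac body_vacuum additive.zero[OF body_additive])
  have D_nat: "D (int n) vac = (\<Sum>k\<le>n. body a (int k) (body b (int n - int k) vac))" for n
    unfolding D_vac
  proof (rule Sum_any.expand_superset)
    show "{k. body a (int k) (body b (int n - int k) vac) \<noteq> 0} \<subseteq> {..n}"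
      using body_vacuum[of "int n - int k" b for k] additive.zero[OF body_additive]
      by (force simp: not_le[symmetric])
  qed simp
  have "body (normal_prod N Y a b) m c = D m c"
  proof (rule body_unique[where D = D, OF _ D_neg _ _ c])
    show "additive (D m)" for m
    proof (unfold additive_def, intro allI)
      fix x y
      have "Sum_any (\<lambda>k. body a (f k) (body b (m - int k) (x + y))) =
          Sum_any (\<lambda>k. body a (f k) (body b (m - int k) x))
          + Sum_any (\<lambda>k. body a (f k) (body b (m - int k) y))" for a b f m
        by (simp add: additive.add[OF body_additive] Sum_any.distrib[OF fin fin])
      then show "D m (x + y) = D m x + D m y"
        by (simp add: D_def normal_order_def pole_prod_def scale_right_distrib)
    qed
    show "D 0 vac = normal_prod N Y a b"
      using D_nat[of 0] by (simp add: normal_prod_eq_body body_creation)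
    show "normal_prod N Y a b \<in> homog V0 V1 (p + q)"
      unfolding normal_prod_eq_body by (rule body_parity[OF a b])
    have "(- 1) ^ ((p + q) * r) = (- 1) ^ (p * r) * (- 1 :: complex) ^ (q * r)"
      by (simp add: add_mult_distrib power_add)
    then show "local_fields ((- 1) ^ ((p + q) * r)) D (body c)"
      using Dong[OF body_linear body_field body_linear body_field body_linear
          body_local[OF a b] body_local[OF a c] body_local[OF b c]]
      by (simp add: D_def)
    fix n
    \<comment> \<open>These are the terms of \<open>D (int n + 1) vac\<close>. In the term of index
      \<open>k\<close> of \<open>D (int n) vac\<close>, \<open>T\<close> raises the index of either
      \<open>a\<close> or \<open>b\<close>, giving multiples of \<open>u (Suc k)\<close> and
      \<open>u k\<close>.\<close>
    define u where "u k = body a (int k) (body b (int n + 1 - int k) vac)" for k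
    have "T (body a (int k) (body b (int n - int k) vac)) =
        scale (of_nat (Suc k)) (u (Suc k)) + scale (of_int (int n - int k + 1)) (u k)" for k
    proof -
      have "int n - int k + 1 = int n + 1 - int k"
        by simp
      then have b1: "T (body b (int n - int k) vac) =
          scale (of_int (int n - int k + 1)) (body b (int n + 1 - int k) vac)"
        using body_translation_vac[OF b, of "int n - int k"] by (simp only:)
      have "T (body a (int k) (body b (int n - int k) vac)) =
          scale (of_int (int k + 1)) (body a (int k + 1) (body b (int n - int k) vac))
          + body a (int k) (T (body b (int n - int k) vac))"
        using body_translation[OF a, of "int k" "body b (int n - int k) vac"] by (simp only: diff_eq_eq)
      then show ?thesis
        by (simp add: b1 linear_scale[OF body_linear] u_def add.commute)
    qed
    then have "T (D (int n) vac) =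
        (\<Sum>k\<le>n. scale (of_nat (Suc k)) (u (Suc k))) + (\<Sum>k\<le>n. scale (of_int (int n - int k + 1)) (u k))"
      by (simp add: D_nat additive.sum[OF additive_linear[OF T_linear]] sum.distrib del: of_nat_Suc)
    \<comment> \<open>Both sums are extended to \<open>k \<le> Suc n\<close>: the added terms,
      \<open>k = 0\<close> here and \<open>k = Suc n\<close> in the other sum, have coefficient 0.
      The coefficients then add up to k + (n + 1 - k) = n + 1.\<close>
    also have "(\<Sum>k\<le>n. scale (of_nat (Suc k)) (u (Suc k))) = (\<Sum>k\<le>Suc n. scale (of_nat k) (u k))"
      by (simp add: sum.atMost_Suc_shift del: sum.atMost_Suc of_nat_Suc)
    also have "(\<Sum>k\<le>n. scale (of_int (int n - int k + 1)) (u k)) =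
        (\<Sum>k\<le>Suc n. scale (of_int (int n - int k + 1)) (u k))"
      by simp
    also have "(\<Sum>k\<le>Suc n. scale (of_nat k) (u k)) + \<dots> = (\<Sum>k\<le>Suc n. scale (of_nat (Suc n)) (u k))"
      unfolding sum.distrib[symmetric] scale_left_distrib[symmetric] by (simp add: add.commute)
    also have "\<dots> = scale (of_nat (Suc n)) (D (int n + 1) vac)"
    proof -
      have "int (Suc n) = int n + 1" by simp
      from D_nat[of "Suc n", unfolded this] show ?thesis
        by (simp only: u_def scale_sum_right)
    qed
    finally show "T (D (int n) vac) = scale (of_nat (Suc n)) (D (int n + 1) vac)" .
  qed
  then show ?thesis by (simp add: D_def)
qed

lemma quasi_associativity:
  assumes "a \<in> homog V0 V1 p" "b \<in> homog V0 V1 q" "c \<in> homog V0 V1 r"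
  shows "normal_prod N Y (normal_prod N Y a b) c - normal_prod N Y a (normal_prod N Y b c) =
     Sum_any (\<lambda>j. mode N Y a (- 2 - int j) {1..N} (mode N Y b (int j) {1..N} c))
     + scale ((- 1) ^ (p * q))
         (Sum_any (\<lambda>j. mode N Y b (- 2 - int j) {1..N} (mode N Y a (int j) {1..N} c)))"
proof -
  have "normal_prod N Y (normal_prod N Y a b) c =
      normal_order ((- 1) ^ (p * q)) (body a) (body b) 0 c"
    using body_normal_prod[OF assms] by (simp add: normal_prod_eq_body)
  moreover have "Sum_any (\<lambda>k. body a (int k) (body b (0 - int k) c)) =
      body a 0 (body b 0 c) + Sum_any (\<lambda>k. body a (1 + int k) (body b (- 1 - int k) c))"
    by (subst Sum_any_nat_split[OF finite_support_comp[OF body_linear body_field]])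
      (simp add: algebra_simps)
  ultimately show ?thesis
    unfolding mode_eq_body
    by (simp add: normal_order_def pole_prod_def normal_prod_eq_body)
qed

end


section \<open>The integral of the \<open>\<Lambda>\<close>-bracket\<close>

text \<open>The derivative in the last variable acts innermost and has to pass all earlier
  variables; the signs accumulate to the exponent 0 + 1 + ... + (N - 1).\<close>

lemma foldr_deriv_chi_all:
  "foldr deriv_chi [1..<Suc N] P {} = smult ((- 1) ^ (N * (N - 1) div 2)) (P {1..N})"
proof (induction N arbitrary: P)
  case (Suc N)
  have "{(j, k). j \<in> {Suc N} \<and> k \<in> {1..N} \<and> k < j} = {Suc N} \<times> {1..N}"
    by auto
  then have "grass_sign {Suc N} {1..N} = (- 1) ^ N"
    by (simp add: grass_sign_def)
  moreover have "insert (Suc N) {1..N} = {1..Suc N}"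
    by auto
  moreover have "Suc N * (Suc N - 1) div 2 = N * (N - 1) div 2 + N"
    by (cases N) simp_all
  ultimately show ?case
    using Suc.IH[of "deriv_chi (Suc N) P"] by (simp add: deriv_chi_def power_add mult.commute)
qed simp

lemma sigma_full: "sigma N {1..N} = 1"
  by (simp add: sigma_def grass_sign_def)

context susy_vertex_algebra
begin

lemma nabla_int_lam_monom:
  "nabla_int scale N T (lam_monom j J) a =
    (if J = {1..N} then scale ((- 1) ^ (N * (N - 1) div 2) / of_nat (j + 1)) ((T ^^ (j + 1)) a) else 0)"
proof (cases "J = {1..N}")
  case True
  define s :: complex where "s = (- 1) ^ (N * (N - 1) div 2)"
  have "s \<noteq> 0" by (simp add: s_def)
  have "nabla_int scale N T (lam_monom j J) a =
      (\<Sum>k\<le>j. scale (coeff (monom s j) k / of_nat (k + 1)) ((T ^^ (k + 1)) a))"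
    using \<open>s \<noteq> 0\<close> True
    by (simp only: nabla_int_def foldr_deriv_chi_all lam_monom_def Let_def smult_monom
        s_def[symmetric] if_True simp_thms mult_1_right degree_monom_eq)
  also have "\<dots> = (\<Sum>k\<le>j. if k = j then scale (s / of_nat (j + 1)) ((T ^^ (j + 1)) a) else 0)"
    by (rule sum.cong) auto
  finally show ?thesis using True by (simp add: s_def)
next
  case False
  then show ?thesis
    by (simp only: nabla_int_def foldr_deriv_chi_all lam_monom_def Let_def) auto
qed

lemma nabla_int_apply_lambda_bracket:
  assumes a: "a \<in> homog V0 V1 p" and b: "b \<in> homog V0 V1 q" and c: "c \<in> homog V0 V1 r"
  shows "nabla_int_apply scale N T Y a (lambda_bracket scale N Y b c) =
    Sum_any (\<lambda>j. mode N Y a (- 2 - int j) {1..N} (mode N Y b (int j) {1..N} c))"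
proof -
  define s t :: complex
    where "s = (- 1) ^ (N * (N - 1) div 2)" and "t = (- 1) ^ (N * N) * (- 1) ^ (N * (N + 1) div 2)"
  have st: "s * t = 1"
  proof -
    have "N * (N - 1) div 2 + N * (N + 1) div 2 = N * N"
    proof -
      have "N * (N - 1) div 2 + N * (N + 1) div 2 = (N * (N - 1) + N * (N + 1)) div 2"
        by (rule div_plus_div_distrib_dvd_left[symmetric]) (cases N; simp)
      also have "N * (N - 1) + N * (N + 1) = 2 * (N * N)"
        by (cases N) simp_all
      finally show ?thesis by simp
    qed
    then have "s * t = (- 1) ^ (N * N) * (- 1) ^ (N * N)"
      unfolding s_def t_def by (metis (no_types) mult.left_commute power_add)
    then show ?thesis by (simp flip: power_add mult_2)
  qed
  have A: "additive (\<lambda>u. normal_prod N Y u v)" and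
    A_scale: "normal_prod N Y (scale e u) v = scale e (normal_prod N Y u v)" for u v e
    unfolding normal_prod_def mode_def
    by (rule additive_linear[OF Y_linear]) (rule linear_scale[OF Y_linear])
  have component: "normal_prod N Y (nabla_int scale N T (lam_monom j {1..N}) a)
      (lambda_bracket scale N Y b c j {1..N}) =
      mode N Y a (- 2 - int j) {1..N} (mode N Y b (int j) {1..N} c)" for j
  proof -
    define w where "w = mode N Y b (int j) {1..N} c"
    \<comment> \<open>\<open>body_T_funpow\<close> is applied to the vector \<open>w\<close>, so
      \<open>w\<close> has to be homogeneous.\<close>
    have w: "w \<in> homog V0 V1 (q + r)"
      unfolding w_def mode_eq_body by (rule body_parity[OF b c])
    define x where "x = (T ^^ (j + 1)) a"
    have int: "nabla_int scale N T (lam_monom j {1..N}) a = scale (s / of_nat (j + 1)) x"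
      by (simp only: nabla_int_lam_monom s_def x_def if_True simp_thms)
    have bracket: "lambda_bracket scale N Y b c j {1..N} = scale (t / fact j) w"
      by (simp only: lambda_bracket_def sigma_full t_def w_def subset_refl if_True card_atLeastAtMost
          diff_Suc_1 mult_1_right times_divide_eq_right Suc_eq_plus1[symmetric])
    have "normal_prod N Y (nabla_int scale N T (lam_monom j {1..N}) a)
        (lambda_bracket scale N Y b c j {1..N}) = scale (s * t / (of_nat (j + 1) * fact j)) (body x 0 w)"
      unfolding int bracket A_scale
      by (simp add: normal_prod_eq_body linear_scale[OF body_linear] mult_ac)
    \<comment> \<open>The Pochhammer factor at 1 is (j + 1)!, which cancels j + 1 from the integral
      and j! from the bracket.\<close>
    also have "\<dots> = body a (int (Suc j)) w"
      using body_T_funpow[OF a w, of "j + 1" 0]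
      by (simp add: x_def st pochhammer_fact[symmetric] add.commute del: funpow.simps of_nat_Suc)
    finally show ?thesis unfolding mode_eq_body w_def by simp
  qed
  have "(\<Sum>J\<in>Pow {1..N}. normal_prod N Y (nabla_int scale N T (lam_monom j J) a)
      (lambda_bracket scale N Y b c j J)) =
      (\<Sum>J\<in>Pow {1..N}. if J = {1..N} then
        mode N Y a (- 2 - int j) {1..N} (mode N Y b (int j) {1..N} c) else 0)"
    for j
    by (rule sum.cong) (use component in \<open>auto simp: nabla_int_lam_monom additive.zero[OF A]\<close>)
  then show ?thesis by (simp add: nabla_int_apply_def)
qed

end

theorem theorem3p3p18:
  fixes scale :: "complex \<Rightarrow> 'v::ab_group_add \<Rightarrow> 'v"
    and V0 V1 :: "'v set" and N :: nat and vac :: 'v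
    and T :: "'v \<Rightarrow> 'v" and S :: "nat \<Rightarrow> 'v \<Rightarrow> 'v" and Y :: "'v \<Rightarrow> 'v sdist"
    and a b c :: 'v and p q r :: nat
  assumes "susy_vertex_algebra scale V0 V1 N vac T S Y"
    and "a \<in> homog V0 V1 p" and "b \<in> homog V0 V1 q" and "c \<in> homog V0 V1 r"
  shows "normal_prod N Y (normal_prod N Y a b) c - normal_prod N Y a (normal_prod N Y b c) =
           Sum_any (\<lambda>j. mode N Y a (- 2 - int j) {1..N} (mode N Y b (int j) {1..N} c))
           + scale ((- 1) ^ (p * q))
               (Sum_any (\<lambda>j. mode N Y b (- 2 - int j) {1..N} (mode N Y a (int j) {1..N} c)))
       \<and> normal_prod N Y (normal_prod N Y a b) c - normal_prod N Y a (normal_prod N Y b c) =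
           nabla_int_apply scale N T Y a (lambda_bracket scale N Y b c)
           + scale ((- 1) ^ (p * q)) (nabla_int_apply scale N T Y b (lambda_bracket scale N Y a c))"
proof -
  interpret susy_vertex_algebra scale V0 V1 N vac T S Y by fact
  show ?thesis
    unfolding nabla_int_apply_lambda_bracket[OF assms(2-4)]
      nabla_int_apply_lambda_bracket[OF assms(3,2,4)]
    using quasi_associativity[OF assms(2-4)] by simp
qed

end
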